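(* Let $h,m,n,a$ be positive integers and $\varepsilon\in\{-1,1\}$. Then \[ \frac{\gcd(2,n)}{n(n+1)(n+2)}\sum_{k=1}^{n}\varepsilon^{k}k^a(k+1)^a(2k+1)D_{k}^{(h)}(x)^{m}\in\mathbb{Z}[x]. \]
   Context: For $h\in\mathbb{Z}^{+}$ and $n\in\mathbb{N}$, the generalized Delannoy (Schmidt) polynomial is $D_n^{(h)}(x)=\sum_{k=0}^{n}\binom{n+k}{2k}^{h}\binom{2k}{k}^{h}x^{k}=\sum_{k=0}^{n}\binom{n}{k}^h\binom{n+k}{k}^h x^k$. Here $\gcd(2,n)$ denotes the greatest common divisor of $2$ and $n$. *)

theory Defs
  imports Complex_Main "HOL-Computational_Algebra.Polynomial"
begin

definition delannoy_poly :: "nat \<Rightarrow> nat \<Rightarrow> rat poly" where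
  "delannoy_poly h n =
     (\<Sum>k=0..n. monom (of_nat (((n + k) choose (2 * k)) ^ h * ((2 * k) choose k) ^ h)) k)"

(* The subring Z[x] of Q[x]. *)
definition int_polys :: "rat poly set" where
  "int_polys = range (map_poly (of_int :: int \<Rightarrow> rat))"

lemma delannoy_poly_altdef:
  "delannoy_poly h n =
     (\<Sum>k=0..n. monom (of_nat ((n choose k) ^ h * ((n + k) choose k) ^ h)) k)"
proof -
  have "((n + k) choose (2 * k)) * ((2 * k) choose k) = (n choose k) * ((n + k) choose k)"
    if "k \<le> n" for k
  proof -
    have "((n + k) choose (2 * k)) * ((2 * k) choose k)
        = ((n + k) choose k) * ((n + k - k) choose (2 * k - k))"
      using that by (intro choose_mult) auto
    then show ?thesis
      by (simp add: mult.commute)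
  qed
  then show ?thesis
    unfolding delannoy_poly_def power_mult_distrib [symmetric]
    by (intro sum.cong) auto
qed

end

theory Submission
  imports Defs
begin

text \<open>
  Put \<open>v\<^sub>l(k) = (k choose l) (k + l choose l)\<close> (\<open>delannoy_coeff l k\<close>), a polynomial of degree \<open>l\<close> in \<open>k (k + 1)\<close>.
  Products \<open>v\<^sub>i v\<^sub>j\<close> are integer combinations of the \<open>v\<^sub>l\<close>, so, for \<open>k \<le> n\<close>,
  \<open>k\<^sup>a\<^sup>-\<^sup>1 (k + 1)\<^sup>a\<^sup>-\<^sup>1 D\<^sub>k(x)\<^sup>m\<close> is a combination of the \<open>v\<^sub>l(k)\<close> with
  coefficients in \<open>\<int>[x]\<close> not depending on \<open>k\<close> (note \<open>v\<^sub>1(k) = k (k + 1)\<close>). It remains to treat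
  \<open>\<Sum>\<epsilon>\<^sup>k k (k + 1) (2 k + 1) v\<^sub>l(k)\<close>, which telescopes for both signs.
\<close>

section \<open>The numbers v_l(k) and their recurrences in l and in k\<close>

definition delannoy_coeff :: "nat \<Rightarrow> nat \<Rightarrow> nat" where
  "delannoy_coeff l k = (k choose l) * ((k + l) choose l)"

text \<open>Working in a ring keeps \<open>k - l\<close> a true difference, so no condition on
  \<open>l\<close> arises: for \<open>l > k\<close> both binomials vanish.\<close>

lemma of_nat_binomial_Suc_lower:
  "of_nat (Suc l) * of_nat (k choose Suc l) = (of_nat k - of_nat l) * (of_nat (k choose l) :: 'a :: comm_ring_1)"
proof (cases "l \<le> k")
  case True
  have "Suc l * (k choose Suc l) = (k - l) * (k choose l)"
    by (metis binomial_absorb_comp binomial_absorption)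
  then have "of_nat (Suc l * (k choose Suc l)) = (of_nat ((k - l) * (k choose l)) :: 'a)"
    by simp
  then show ?thesis
    using True by (simp only: of_nat_mult of_nat_diff)
qed (simp add: binomial_eq_0)

lemma of_nat_binomial_Suc_upper:
  "(of_nat (Suc k) - of_nat l) * of_nat (Suc k choose l) = of_nat (Suc k) * (of_nat (k choose l) :: 'a :: comm_ring_1)"
proof (cases "l \<le> Suc k")
  case True
  have "(Suc k - l) * (Suc k choose l) = Suc k * (k choose l)"
    using binomial_absorb_comp[of "Suc k" l] by simp
  then have "of_nat ((Suc k - l) * (Suc k choose l)) = (of_nat (Suc k * (k choose l)) :: 'a)"
    by simp
  then show ?thesis
    using True by (simp only: of_nat_mult of_nat_diff)
qed (simp add: binomial_eq_0)

lemma delannoy_coeff_0_left [simp]: "delannoy_coeff 0 k = 1"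
  by (simp add: delannoy_coeff_def)

lemma delannoy_coeff_1: "delannoy_coeff (Suc 0) k = k * (k + 1)"
  by (simp add: delannoy_coeff_def)

lemma delannoy_coeff_eq_0: "k < l \<Longrightarrow> delannoy_coeff l k = 0"
  by (simp add: delannoy_coeff_def)

text \<open>The two binomials contribute the factors \<open>k - l\<close> and
  \<open>k + l + 1\<close>, whose product is \<open>k (k + 1) - l (l + 1)\<close>. Hence passing
  from v_l to v_(l+1) multiplies by a linear polynomial in \<open>k (k + 1)\<close>, up to the
  constant \<open>(l + 1)^2\<close>.\<close>

lemma delannoy_coeff_Suc_left:
  "of_nat (Suc l) ^ 2 * of_nat (delannoy_coeff (Suc l) k) =
     (of_nat k * (of_nat k + 1) - of_nat l * (of_nat l + 1)) * (of_nat (delannoy_coeff l k) :: 'a :: comm_ring_1)"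
proof -
  have "of_nat (Suc l) * of_nat ((k + Suc l) choose Suc l) =
      (of_nat k + of_nat l + 1) * (of_nat ((k + l) choose l) :: 'a)"
    using arg_cong[OF Suc_times_binomial[of l "k + l"], of "of_nat :: nat \<Rightarrow> 'a"]
    by (simp add: algebra_simps)
  moreover note of_nat_binomial_Suc_lower[of l k, where 'a = 'a]
  ultimately have "(of_nat (Suc l) * of_nat (k choose Suc l)) * (of_nat (Suc l) * of_nat ((k + Suc l) choose Suc l)) =
      ((of_nat k - of_nat l) * of_nat (k choose l)) * ((of_nat k + of_nat l + 1) * (of_nat ((k + l) choose l) :: 'a))"
    by (simp only:)
  then show ?thesis
    by (simp only: delannoy_coeff_def of_nat_mult) (simp add: algebra_simps power2_eq_square)
qed

text \<open>Absorption in the second binomial. It serves the recurrence in \<open>n\<close> and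
  later exposes the factor \<open>n + 1\<close> of the denominator when the signs alternate.\<close>

lemma delannoy_coeff_Suc_right_absorb:
  "(n + 1 + l) * delannoy_coeff l n = (n + 1) * ((n choose l) * ((n + l + 1) choose l))"
proof -
  have "(n + l + 1) * ((n + l) choose l) = (n + 1) * ((n + l + 1) choose l)"
    using binomial_absorb_comp[of "n + l + 1" l] by simp
  moreover have "(n + 1 + l) * delannoy_coeff l n = (n choose l) * ((n + l + 1) * ((n + l) choose l))"
    unfolding delannoy_coeff_def by (simp only: ac_simps)
  ultimately show ?thesis
    by (simp only: mult.left_commute)
qed

text \<open>Both sides equal \<open>(n + 1) * (n choose l) * ((n + l + 1) choose l)\<close>. This
  drives both telescoping sums: a closed form at \<open>n\<close> becomes a multiple of
  v_l(n+1).\<close>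

lemma delannoy_coeff_Suc_right:
  "(of_nat n + 1 - of_nat l) * of_nat (delannoy_coeff l (Suc n)) =
     (of_nat n + 1 + of_nat l) * (of_nat (delannoy_coeff l n) :: 'a :: comm_ring_1)"
proof -
  have "(of_nat n + 1 - of_nat l) * of_nat (Suc n choose l) = (of_nat n + 1) * (of_nat (n choose l) :: 'a)"
    using of_nat_binomial_Suc_upper[of n l, where 'a = 'a] by (simp only: of_nat_Suc add.commute)
  then have "(of_nat n + 1 - of_nat l) * of_nat (delannoy_coeff l (Suc n)) =
      (of_nat n + 1) * (of_nat (n choose l) * (of_nat ((n + l + 1) choose l) :: 'a))"
    unfolding delannoy_coeff_def of_nat_mult by (simp add: mult.assoc[symmetric] add.commute)
  also have "\<dots> = of_nat ((n + 1 + l) * delannoy_coeff l n)"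
    unfolding delannoy_coeff_Suc_right_absorb by (simp only: of_nat_mult of_nat_add of_nat_1)
  finally show ?thesis
    by (simp only: of_nat_mult of_nat_add of_nat_1)
qed

section \<open>Linearization of products v_i v_j\<close>

text \<open>Induction on \<open>j\<close>: up to \<open>(j + 1)^2\<close>, passing from v_j to
  v_(j+1) is multiplication by \<open>X - j (j + 1)\<close> with \<open>X = k (k + 1)\<close>, and
  this sends v_(i+t) to a combination of v_(i+t) and v_(i+t+1). What matters later is that the
  coefficients are integers free of \<open>k\<close>.\<close>

lemma delannoy_coeff_mult:
  "of_nat (delannoy_coeff i k) * of_nat (delannoy_coeff j k) =
     (\<Sum>t\<le>j. of_nat (((i + j) choose i) * (j choose t) * ((i + t) choose j)) *
        (of_nat (delannoy_coeff (i + t) k) :: rat))"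
proof (induction j)
  case 0
  then show ?case by simp
next
  case (Suc j)
  define v :: "nat \<Rightarrow> rat" where "v l = of_nat (delannoy_coeff l k)" for l
  define b :: "nat \<Rightarrow> nat \<Rightarrow> rat" where "b n r = of_nat (n choose r)" for n r
  define X :: rat where "X = of_nat k * (of_nat k + 1)"
  define J I :: rat where "J = of_nat j" and "I = of_nat i"
  define c where "c t = b (i + j) i * b j t * b (i + t) j" for t
  define c' where "c' t = b (i + Suc j) i * b (Suc j) t * b (i + t) (Suc j)" for t
  have v_Suc: "(of_nat l + 1) ^ 2 * v (Suc l) = (X - of_nat l * (of_nat l + 1)) * v l" for l
    using delannoy_coeff_Suc_left[of l k, where 'a = rat] by (simp add: v_def X_def add.commute)
  have b1: "(J + 1) * b (i + Suc j) i = (I + J + 1) * b (i + j) i"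
    using of_nat_binomial_Suc_upper[of "i + j" i, where 'a = rat]
    by (simp add: b_def I_def J_def algebra_simps)
  have b2: "(J + 1) * b N (Suc j) = (of_nat N - J) * b N j" for N
    using of_nat_binomial_Suc_lower[of j N, where 'a = rat] by (simp add: b_def J_def add.commute)
  \<comment> \<open>\<open>c'_0\<close> and \<open>c'_Suc\<close> are what comparing coefficients of
    \<open>v (i + t)\<close> demands: a diagonal contribution from index \<open>t\<close> and a
    raised one from index \<open>t - 1\<close>, the latter being absent at index 0.\<close>
  have c'_0: "(J + 1) ^ 2 * c' 0 = c 0 * (I * (I + 1) - J * (J + 1))"
  proof -
    have "(J + 1) ^ 2 * c' 0 = ((J + 1) * b (i + Suc j) i) * ((J + 1) * b i (Suc j))"
      by (simp add: c'_def power2_eq_square b_def)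
    also have "\<dots> = c 0 * (I * (I + 1) - J * (J + 1))"
      unfolding b1 b2 by (simp add: c_def I_def b_def algebra_simps)
    finally show ?thesis .
  qed
  have c'_Suc: "(J + 1) ^ 2 * c' (Suc t) =
      c (Suc t) * ((I + of_nat t + 1) * (I + of_nat t + 2) - J * (J + 1)) + c t * (I + of_nat t + 1) ^ 2" for t
  proof -
    define L A B U V where "L = I + of_nat t + 1" and "A = b j (Suc t)" and "B = b j t"
      and "U = b (i + Suc t) j" and "V = b (i + t) j"
    have AB: "(of_nat t + 1) * A = (J - of_nat t) * B"
      using of_nat_binomial_Suc_lower[of t j, where 'a = rat]
      by (simp add: A_def B_def b_def J_def add.commute)
    have UV: "(L - J) * U = L * V"
      using of_nat_binomial_Suc_upper[of "i + t" j, where 'a = rat]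
      by (simp add: U_def V_def b_def J_def L_def I_def algebra_simps)
    have "(J + 1) ^ 2 * c' (Suc t) =
        ((J + 1) * b (i + Suc j) i) * (A + B) * ((J + 1) * b (i + Suc t) (Suc j))"
      by (simp add: c'_def power2_eq_square A_def B_def b_def algebra_simps)
    also have "\<dots> = b (i + j) i * ((I + J + 1) * (A + B)) * ((L - J) * U)"
      unfolding b1 b2 by (simp add: U_def L_def I_def algebra_simps)
    \<comment> \<open>As \<open>I + J + 1 = L + (J - t)\<close>, the relation \<open>AB\<close>
      trades \<open>(J - t) * B\<close> for \<open>(t + 1) * A\<close>. Then
      \<open>(L + J + 1) * (L - J) = L * (L + 1) - J * (J + 1)\<close> gives the diagonal part, and
      \<open>UV\<close> turns the rest into the raised part.\<close>
    also have "(I + J + 1) * (A + B) = A * (L + J + 1) + L * B"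
      using AB by (simp add: L_def algebra_simps)
    also have "b (i + j) i * (A * (L + J + 1) + L * B) * ((L - J) * U) =
        b (i + j) i * A * U * (L * (L + 1) - J * (J + 1)) + b (i + j) i * L * B * ((L - J) * U)"
      by (simp add: algebra_simps)
    also have "\<dots> = c (Suc t) * (L * (L + 1) - J * (J + 1)) + c t * L ^ 2"
      unfolding UV by (simp add: c_def A_def B_def U_def V_def power2_eq_square algebra_simps)
    finally show ?thesis
      by (simp add: L_def add.assoc)
  qed
  define f where "f t = c t * ((I + of_nat t) * (I + of_nat t + 1) - J * (J + 1)) * v (i + t)" for t
  \<comment> \<open>Since \<open>j choose Suc j\<close> is 0, the diagonal sum may be extended to
    \<open>Suc j\<close> and its tail matched with the raised sum.\<close>
  have f_last: "f (Suc j) = 0"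
    by (simp add: f_def c_def b_def)
  \<comment> \<open>Split \<open>X - J (J + 1)\<close> at \<open>(I + t) (I + t + 1)\<close>: the
    upper difference raises \<open>v (i + t)\<close> by the recurrence in \<open>l\<close>, the
    lower one is a scalar and yields \<open>f t\<close>.\<close>
  have step: "(X - J * (J + 1)) * (c t * v (i + t)) =
      f t + c t * (I + of_nat t + 1) ^ 2 * v (Suc (i + t))" for t
  proof -
    have "c t * ((I + of_nat t + 1) ^ 2 * v (Suc (i + t))) =
        c t * ((X - (I + of_nat t) * (I + of_nat t + 1)) * v (i + t))"
      using v_Suc[of "i + t"] by (simp add: I_def)
    then show ?thesis
      by (simp add: f_def algebra_simps)
  qed
  have "(J + 1) ^ 2 * (v i * v (Suc j)) = v i * ((J + 1) ^ 2 * v (Suc j))"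
    by simp
  also have "\<dots> = (X - J * (J + 1)) * (v i * v j)"
    unfolding J_def v_Suc by simp
  also have "v i * v j = (\<Sum>t\<le>j. c t * v (i + t))"
    using Suc.IH by (simp add: v_def c_def b_def)
  also have "(X - J * (J + 1)) * \<dots> =
      (\<Sum>t\<le>j. f t) + (\<Sum>t\<le>j. c t * (I + of_nat t + 1) ^ 2 * v (Suc (i + t)))"
    by (simp add: sum_distrib_left step sum.distrib)
  also have "(\<Sum>t\<le>j. f t) = (\<Sum>t\<le>Suc j. f t)"
    using f_last by simp
  also have "\<dots> = f 0 + (\<Sum>t\<le>j. f (Suc t))"
    by (rule sum.atMost_Suc_shift)
  also have "\<dots> + (\<Sum>t\<le>j. c t * (I + of_nat t + 1) ^ 2 * v (Suc (i + t))) =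
      (J + 1) ^ 2 * c' 0 * v i + (\<Sum>t\<le>j. (J + 1) ^ 2 * c' (Suc t) * v (i + Suc t))"
    unfolding c'_0 c'_Suc by (simp add: f_def sum.distrib[symmetric] algebra_simps)
  also have "\<dots> = (\<Sum>t\<le>Suc j. (J + 1) ^ 2 * c' t * v (i + t))"
    by (subst sum.atMost_Suc_shift) simp
  also have "\<dots> = (J + 1) ^ 2 * (\<Sum>t\<le>Suc j. c' t * v (i + t))"
    by (simp only: sum_distrib_left mult.assoc)
  finally have "(J + 1) ^ 2 * (v i * v (Suc j)) = (J + 1) ^ 2 * (\<Sum>t\<le>Suc j. c' t * v (i + t))" .
  moreover have "J + 1 \<noteq> 0"
    unfolding J_def by (metis of_nat_Suc of_nat_neq_0 add.commute)
  ultimately have "v i * v (Suc j) = (\<Sum>t\<le>Suc j. c' t * v (i + t))"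
    by simp
  then show ?case
    by (simp only: v_def c'_def b_def of_nat_mult)
qed

section \<open>The ring of Z[x]-combinations of the functions v_l\<close>

lemma int_polys_iff: "p \<in> int_polys \<longleftrightarrow> (\<forall>i. coeff p i \<in> \<int>)"
proof
  assume "\<forall>i. coeff p i \<in> \<int>"
  then have "p = map_poly of_int (map_poly floor p)"
    by (intro poly_eqI) (simp add: coeff_map_poly)
  then show "p \<in> int_polys"
    unfolding int_polys_def by blast
qed (auto simp: int_polys_def coeff_map_poly)

lemma int_polys_0 [simp]: "0 \<in> int_polys"
  and int_polys_1 [simp]: "1 \<in> int_polys"
  and int_polys_add: "p \<in> int_polys \<Longrightarrow> q \<in> int_polys \<Longrightarrow> p + q \<in> int_polys"
  and int_polys_smult: "x \<in> \<int> \<Longrightarrow> p \<in> int_polys \<Longrightarrow> smult x p \<in> int_polys"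
  and int_polys_mult: "p \<in> int_polys \<Longrightarrow> q \<in> int_polys \<Longrightarrow> p * q \<in> int_polys"
  and int_polys_monom: "x \<in> \<int> \<Longrightarrow> monom x i \<in> int_polys"
  by (auto simp: int_polys_iff coeff_mult)

text \<open>The Z[x]-module generated by the functions v_l. The coefficient \<open>p\<close> is
  fixed before \<open>k\<close> varies, so sums over \<open>k\<close> can be evaluated generator by
  generator.\<close>

inductive_set delannoy_span :: "(nat \<Rightarrow> rat poly) set" where
  zero: "(\<lambda>k. 0) \<in> delannoy_span"
| basis: "p \<in> int_polys \<Longrightarrow> (\<lambda>k. smult (of_nat (delannoy_coeff l k)) p) \<in> delannoy_span"
| add: "f \<in> delannoy_span \<Longrightarrow> g \<in> delannoy_span \<Longrightarrow> (\<lambda>k. f k + g k) \<in> delannoy_span"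

lemma delannoy_span_sum:
  assumes "finite A" and "\<And>i. i \<in> A \<Longrightarrow> f i \<in> delannoy_span"
  shows "(\<lambda>k. \<Sum>i\<in>A. f i k) \<in> delannoy_span"
  using assms by (induction A) (auto intro: delannoy_span.intros)

text \<open>The linearization coefficients are integers free of \<open>k\<close>, so they can be
  absorbed into the polynomial \<open>p * q\<close>.\<close>

lemma delannoy_span_basis_mult_basis:
  assumes "p \<in> int_polys" and "q \<in> int_polys"
  shows "(\<lambda>k. smult (of_nat (delannoy_coeff i k)) p * smult (of_nat (delannoy_coeff j k)) q) \<in> delannoy_span"
proof -
  have "(\<lambda>k. smult (of_nat (delannoy_coeff i k)) p * smult (of_nat (delannoy_coeff j k)) q) =
      (\<lambda>k. \<Sum>t\<le>j. smult (of_nat (delannoy_coeff (i + t) k))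
        (smult (of_nat (((i + j) choose i) * (j choose t) * ((i + t) choose j))) (p * q)))"
    using delannoy_coeff_mult[of i _ j]
    by (simp add: mult.commute smult_sum[symmetric])
  also have "\<dots> \<in> delannoy_span"
    using assms
    by (intro delannoy_span_sum delannoy_span.basis int_polys_smult int_polys_mult) auto
  finally show ?thesis .
qed

lemma delannoy_span_mult:
  assumes "f \<in> delannoy_span" and "g \<in> delannoy_span"
  shows "(\<lambda>k. f k * g k) \<in> delannoy_span"
  using assms(1)
proof (induction rule: delannoy_span.induct)
  case zero
  then show ?case by (simp add: delannoy_span.zero)
next
  case (basis p l)
  from assms(2) show ?case
  proof (induction rule: delannoy_span.induct)
    case zero
    then show ?case by (simp add: delannoy_span.zero)
  next
    case (basis q j)
    then show ?case using delannoy_span_basis_mult_basis \<open>p \<in> int_polys\<close> by blast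
  next
    case (add g g')
    from delannoy_span.add[OF add.IH] show ?case by (simp add: distrib_left)
  qed
next
  case (add f f')
  from delannoy_span.add[OF add.IH] show ?case by (simp add: distrib_right)
qed

lemma delannoy_span_power:
  assumes "f \<in> delannoy_span"
  shows "(\<lambda>k. f k ^ m) \<in> delannoy_span"
proof (induction m)
  case 0
  show ?case using delannoy_span.basis[OF int_polys_1, of 0] by (simp add: one_pCons)
next
  case (Suc m)
  from delannoy_span_mult[OF assms Suc] show ?case by simp
qed

lemma delannoy_span_coeff_power:
  "(\<lambda>k. smult (of_nat (delannoy_coeff l k) ^ h) 1) \<in> delannoy_span"
proof -
  have "(\<lambda>k. smult (of_nat (delannoy_coeff l k)) 1 ^ h) \<in> delannoy_span"
    by (intro delannoy_span_power delannoy_span.basis) simp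
  then show ?thesis
    by (simp only: smult_power power_one)
qed

lemma delannoy_span_Schmidt_sum:
  "(\<lambda>k. \<Sum>i\<le>n. monom (of_nat (delannoy_coeff i k) ^ h) i) \<in> delannoy_span"
proof (rule delannoy_span_sum)
  fix i
  \<comment> \<open>\<open>delannoy_coeff 0 k\<close> is the constant 1, which presents the monomial
    of degree \<open>i\<close> as an element of the span.\<close>
  have "(\<lambda>k. smult (of_nat (delannoy_coeff i k) ^ h) 1 * smult (of_nat (delannoy_coeff 0 k)) (monom 1 i)) \<in> delannoy_span"
    by (intro delannoy_span_mult delannoy_span_coeff_power delannoy_span.basis int_polys_monom) simp
  then show "(\<lambda>k. monom (of_nat (delannoy_coeff i k) ^ h) i) \<in> delannoy_span"
    by (simp add: smult_monom)
qed simp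

text \<open>The added terms vanish because v_i(k) = 0 for \<open>i > k\<close> and
  \<open>0 ^ h = 0\<close> for \<open>h > 0\<close>. The bound \<open>n\<close> is common to all
  \<open>k\<close> in the sum, as membership in the span requires a fixed index set.\<close>

lemma delannoy_poly_eq_sum_delannoy_coeff:
  assumes "h > 0" and "k \<le> n"
  shows "delannoy_poly h k = (\<Sum>i\<le>n. monom (of_nat (delannoy_coeff i k) ^ h) i)"
proof -
  have "delannoy_poly h k = (\<Sum>i\<le>k. monom (of_nat (delannoy_coeff i k) ^ h) i)"
    by (simp add: delannoy_poly_altdef delannoy_coeff_def atLeast0AtMost power_mult_distrib)
  also have "\<dots> = (\<Sum>i\<le>n. monom (of_nat (delannoy_coeff i k) ^ h) i)"
    using assms by (intro sum.mono_neutral_left) (auto simp: delannoy_coeff_eq_0)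
  finally show ?thesis .
qed

section \<open>Closed forms of the two weighted sums\<close>

text \<open>The recurrence in \<open>n\<close> turns the induction hypothesis and the new term into
  multiples of v_l(n+1), leaving a polynomial identity. The factor \<open>l + 2\<close> is kept on
  the left to avoid a quotient.\<close>

lemma sum_delannoy_coeff:
  "(of_nat l + 2) * (\<Sum>k=1..n. of_nat k * (of_nat k + 1) * (2 * of_nat k + 1) * of_nat (delannoy_coeff l k)) =
     of_nat n * (of_nat n + 1) * (of_nat n + 2) * ((of_nat n + 1 + of_nat l) * (of_nat (delannoy_coeff l n) :: rat))"
proof (induction n)
  case (Suc n)
  have "(of_nat l + 2) * (\<Sum>k=1..Suc n. of_nat k * (of_nat k + 1) * (2 * of_nat k + 1) * of_nat (delannoy_coeff l k)) =
      of_nat n * (of_nat n + 1) * (of_nat n + 2) * ((of_nat n + 1 - of_nat l) * (of_nat (delannoy_coeff l (Suc n)) :: rat))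
      + (of_nat l + 2) * ((of_nat n + 1) * (of_nat n + 2) * (2 * of_nat n + 3) * of_nat (delannoy_coeff l (Suc n)))"
    unfolding delannoy_coeff_Suc_right Suc.IH[symmetric] by (simp add: algebra_simps)
  then show ?case
    by (simp add: algebra_simps)
qed simp

lemma alternating_sum_delannoy_coeff:
  "(\<Sum>k=1..n. (-1) ^ k * (of_nat k * (of_nat k + 1) * (2 * of_nat k + 1)) * of_nat (delannoy_coeff l k)) =
     (-1) ^ n * (of_nat n * (of_nat n + 2) - of_nat l) * ((of_nat n + 1 + of_nat l) * (of_nat (delannoy_coeff l n) :: rat))"
proof (induction n)
  case 0
  \<comment> \<open>The right-hand side is 0 through the factor \<open>- l\<close> when
    \<open>l = 0\<close>, and through v_l(0) = 0 otherwise.\<close>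
  then show ?case by (cases l) (simp_all add: delannoy_coeff_eq_0)
next
  case (Suc n)
  have "(\<Sum>k=1..Suc n. (-1) ^ k * (of_nat k * (of_nat k + 1) * (2 * of_nat k + 1)) * of_nat (delannoy_coeff l k)) =
      (-1) ^ n * (of_nat n * (of_nat n + 2) - of_nat l) * ((of_nat n + 1 - of_nat l) * (of_nat (delannoy_coeff l (Suc n)) :: rat))
      - (-1) ^ n * ((of_nat n + 1) * (of_nat n + 2) * (2 * of_nat n + 3) * of_nat (delannoy_coeff l (Suc n)))"
    unfolding delannoy_coeff_Suc_right Suc.IH[symmetric] by (simp add: algebra_simps)
  then show ?case
    by (simp add: algebra_simps)
qed

section \<open>Divisibility of the closed forms\<close>

text \<open>Two absorptions identify the right-hand number with
  \<open>(l + 2) * ((2 * l + 2) choose l)\<close>.\<close>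

lemma Suc_Suc_dvd_central_binomial: "l + 2 dvd 2 * ((2 * l + 1) * ((2 * l) choose l))"
proof -
  have "(l + 2) * ((2 * l + 2) choose l) = (2 * l + 2) * ((2 * l + 1) choose l)"
    using binomial_absorb_comp[of "2 * l + 2" l] by simp
  also have "\<dots> = 2 * ((l + 1) * ((2 * l + 1) choose l))"
    by simp
  also have "(l + 1) * ((2 * l + 1) choose l) = (2 * l + 1) * ((2 * l) choose l)"
    using binomial_absorb_comp[of "2 * l + 1" l] by simp
  finally show ?thesis
    by (metis dvd_triv_left)
qed

text \<open>This removes the \<open>l + 2\<close> of the non-alternating closed form. The product
  factors as \<open>C * E\<close> where \<open>l + 2\<close> divides \<open>2 * C\<close>, so the
  question is where the 2 comes from: from the gcd for even \<open>n\<close>, from \<open>E\<close>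
  for odd \<open>n\<close> and even \<open>l\<close>; for odd \<open>l\<close> it is coprime to
  \<open>l + 2\<close>.\<close>

lemma delannoy_coeff_sum_dvd:
  "l + 2 dvd gcd 2 n * ((n + 1 + l) * delannoy_coeff l n)"
proof -
  define C where "C = (2 * l + 1) * ((2 * l) choose l)"
  define E where "E = ((n + l + 1) choose (2 * l + 1))"
  have E_absorb: "(2 * l + 1) * E = (n + l + 1) * ((n + l) choose (2 * l))"
    unfolding E_def using Suc_times_binomial[of "2 * l" "n + l"] by simp
  have "delannoy_coeff l n = ((n + l) choose (2 * l)) * ((2 * l) choose l)"
  proof (cases "l \<le> n")
    case True
    then show ?thesis
      using choose_mult[of l "2 * l" "n + l"] by (simp add: delannoy_coeff_def mult.commute)
  qed (simp add: delannoy_coeff_def binomial_eq_0)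
  then have "(n + 1 + l) * delannoy_coeff l n = (n + l + 1) * ((n + l) choose (2 * l)) * ((2 * l) choose l)"
    by (simp only: ac_simps)
  also have "\<dots> = C * E"
    unfolding E_absorb[symmetric] C_def by (simp only: ac_simps)
  finally have eq: "(n + 1 + l) * delannoy_coeff l n = C * E" .
  have dvd2: "l + 2 dvd 2 * C"
    unfolding C_def by (rule Suc_Suc_dvd_central_binomial)
  show ?thesis
  proof (cases "even n")
    case True
    then have "gcd 2 n = 2" by (simp add: gcd_nat.absorb1)
    then show ?thesis unfolding eq using dvd2 by (metis dvd_mult2 mult.assoc)
  next
    case n_odd: False
    have "l + 2 dvd C * E"
    proof (cases "even l")
      case True
      \<comment> \<open>Here \<open>n + l + 1\<close> is even while \<open>2 * l + 1\<close> is
        odd.\<close>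
      then have "even ((2 * l + 1) * E)"
        unfolding E_absorb using n_odd by simp
      then have "even E" by simp
      then obtain E' where "E = 2 * E'" by blast
      then show ?thesis using dvd2 by (metis dvd_mult2 mult.assoc mult.commute)
    next
      case False
      then have "coprime (l + 2) 2" by simp
      then show ?thesis using dvd2 by (meson coprime_dvd_mult_right_iff dvd_mult2)
    qed
    then show ?thesis unfolding eq by (rule dvd_mult)
  qed
qed

text \<open>Absorbing \<open>l\<close> into either binomial shows that \<open>n\<close> and
  \<open>n + 2\<close> each divide the product, hence so does their lcm; the missing factor is
  \<open>gcd n (n + 2) = gcd 2 n\<close>. This handles the \<open>- l\<close> in the alternating
  closed form.\<close>

lemma alternating_delannoy_coeff_sum_dvd:
  "n * (n + 2) dvd gcd 2 n * (l * ((n choose l) * ((n + l + 1) choose l)))"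
    (is "_ dvd _ * ?P")
proof (cases l)
  case (Suc r)
  show ?thesis
  proof (cases n)
    case (Suc n')
    have "?P = n * ((n' choose r) * ((n + l + 1) choose l))"
      using Suc_times_binomial[of r n'] \<open>l = Suc r\<close> Suc by (metis mult.assoc)
    then have 1: "n dvd ?P" by (metis dvd_triv_left)
    \<comment> \<open>For \<open>N = n + l + 1\<close> and \<open>l = Suc r\<close>,
      \<open>l * (N choose l) = (N - r) * (N choose r)\<close> with
      \<open>N - r = n + 2\<close>.\<close>
    have "l * ((n + l + 1) choose l) = (n + 2) * ((n + l + 1) choose r)"
      using binomial_absorb_comp[of "n + l + 1" r] binomial_absorption[of r "n + l + 1"] \<open>l = Suc r\<close>
      by simp
    then have "?P = (n + 2) * ((n choose l) * ((n + l + 1) choose r))"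
      by (metis mult.left_commute)
    then have 2: "n + 2 dvd ?P" by (metis dvd_triv_left)
    have "lcm n (n + 2) dvd ?P" using 1 2 by (rule lcm_least)
    then have "gcd n (n + 2) * lcm n (n + 2) dvd gcd n (n + 2) * ?P" by (rule mult_dvd_mono[OF dvd_refl])
    moreover have "gcd n (n + 2) = gcd 2 n"
      by (metis gcd_add2 gcd.commute)
    ultimately show ?thesis by (simp only: prod_gcd_lcm_nat[of n "n + 2"])
  qed (use Suc in simp)
qed simp

section \<open>Integrality of the normalized sums\<close>

lemma delannoy_coeff_sum_integral:
  fixes \<epsilon> :: rat
  assumes "n > 0" and "\<epsilon> \<in> {-1, 1}"
  shows "of_nat (gcd 2 n) / of_nat (n * (n + 1) * (n + 2)) *
    (\<Sum>k=1..n. \<epsilon> ^ k * (of_nat k * (of_nat k + 1) * (2 * of_nat k + 1)) * of_nat (delannoy_coeff l k)) \<in> \<int>"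
    (is "?q * ?S \<in> _")
proof (cases "\<epsilon> = 1")
  case True
  obtain d where d: "gcd 2 n * ((n + 1 + l) * delannoy_coeff l n) = (l + 2) * d"
    using delannoy_coeff_sum_dvd by blast
  define g N w :: rat where "g = of_nat (gcd 2 n)" and "N = of_nat (n * (n + 1) * (n + 2))"
    and "w = (of_nat n + 1 + of_nat l) * of_nat (delannoy_coeff l n)"
  have N0: "N \<noteq> 0"
    unfolding N_def of_nat_eq_0_iff using assms by simp
  have l0: "(of_nat l + 2 :: rat) \<noteq> 0"
    using of_nat_0_le_iff[of l, where 'a = rat] by linarith
  have "(of_nat l + 2) * ?S = N * w"
    using sum_delannoy_coeff[of l n] True by (simp add: w_def N_def algebra_simps)
  moreover have "g * w = (of_nat l + 2) * of_nat d"
    using arg_cong[OF d, of "of_nat :: nat \<Rightarrow> rat"]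
    by (simp only: g_def w_def of_nat_mult of_nat_add of_nat_1 of_nat_numeral)
  moreover have "(of_nat l + 2) * (?q * ?S) = g / N * ((of_nat l + 2) * ?S)"
    unfolding g_def N_def by (simp only: mult.left_commute)
  ultimately have "(of_nat l + 2) * (?q * ?S) = (of_nat l + 2) * of_nat d"
    using N0 by simp
  then have "?q * ?S = of_nat d"
    by (rule iffD1[OF mult_left_cancel[OF l0]])
  then show ?thesis by simp
next
  case False
  define z where "z = (n choose l) * ((n + l + 1) choose l)"
  obtain d where d: "gcd 2 n * (l * z) = n * (n + 2) * d"
    using alternating_delannoy_coeff_sum_dvd unfolding z_def by blast
  define g s :: rat where "g = of_nat (gcd 2 n)" and "s = (-1) ^ n"
  have dr: "g * (of_nat l * of_nat z) = of_nat n * (of_nat n + 2) * of_nat d"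
    using arg_cong[OF d, of "of_nat :: nat \<Rightarrow> rat"] by (simp only: g_def of_nat_mult of_nat_add of_nat_numeral)
  have w: "(of_nat n + 1 + of_nat l) * of_nat (delannoy_coeff l n) = (of_nat n + 1) * (of_nat z :: rat)"
    using arg_cong[OF delannoy_coeff_Suc_right_absorb[of n l], of "of_nat :: nat \<Rightarrow> rat"]
    by (simp only: z_def of_nat_mult of_nat_add of_nat_1)
  have "\<epsilon> = -1"
    using False assms by simp
  then have S: "?S = s * (of_nat n * (of_nat n + 2) - of_nat l) * ((of_nat n + 1) * of_nat z)"
    using alternating_sum_delannoy_coeff[of l n] unfolding w s_def by (simp only:)
  \<comment> \<open>The term with \<open>n (n + 2)\<close> already carries the denominator together
    with \<open>n + 1\<close>; only \<open>g * (l * z)\<close> needs the divisibility, which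
    replaces it by \<open>n (n + 2) d\<close>.\<close>
  have "g * ?S = s * (of_nat n + 1) * (g * of_nat n * (of_nat n + 2) * of_nat z - g * (of_nat l * of_nat z))"
    unfolding S by (simp add: algebra_simps)
  also have "\<dots> = of_nat (n * (n + 1) * (n + 2)) * (s * (g * of_nat z - of_nat d))"
    unfolding dr by (simp add: algebra_simps)
  finally have gS: "g * ?S = of_nat (n * (n + 1) * (n + 2)) * (s * (g * of_nat z - of_nat d))" .
  have N0: "(of_nat (n * (n + 1) * (n + 2)) :: rat) \<noteq> 0"
    unfolding of_nat_eq_0_iff using assms by simp
  have "?q * ?S = s * (g * of_nat z - of_nat d)"
    unfolding g_def[symmetric] times_divide_eq_left gS using N0 by (rule nonzero_mult_div_cancel_left)
  moreover have "\<dots> \<in> \<int>"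
    unfolding g_def s_def by (intro Ints_mult Ints_diff Ints_power) auto
  ultimately show ?thesis by (simp only:)
qed

text \<open>The expression is additive in \<open>f\<close>, and on a generator it is an integer
  multiple of \<open>p\<close>.\<close>

lemma delannoy_span_sum_integral:
  fixes \<epsilon> :: rat
  assumes "f \<in> delannoy_span" and "n > 0" and "\<epsilon> \<in> {-1, 1}"
  shows "smult (of_nat (gcd 2 n) / of_nat (n * (n + 1) * (n + 2)))
    (\<Sum>k=1..n. smult (\<epsilon> ^ k * (of_nat k * (of_nat k + 1) * (2 * of_nat k + 1))) (f k)) \<in> int_polys"
  using assms(1)
proof (induction rule: delannoy_span.induct)
  case zero
  then show ?case by simp
next
  case (basis p l)
  show ?case
    using int_polys_smult[OF delannoy_coeff_sum_integral[OF assms(2,3), of l] basis]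
    by (simp only: smult_sum[symmetric] smult_smult)
next
  case (add f g)
  from int_polys_add[OF add.IH] show ?case
    by (simp only: smult_add_right sum.distrib)
qed

theorem theorem2p1:
  fixes h m n a :: nat and \<epsilon> :: rat
  assumes "h > 0" and "m > 0" and "n > 0" and "a > 0" and "\<epsilon> \<in> {-1, 1}"
  shows "smult (of_nat (gcd 2 n) / of_nat (n * (n + 1) * (n + 2)))
           (\<Sum>k=1..n. smult (\<epsilon> ^ k * of_nat (k ^ a * (k + 1) ^ a * (2 * k + 1)))
              (delannoy_poly h k ^ m)) \<in> int_polys"
proof -
  \<comment> \<open>One factor \<open>k (k + 1)\<close> stays outside as part of the telescoping
    weight; the other \<open>a - 1\<close> are powers of v_1(k). The inner sum up to
    \<open>n\<close> agrees with the polynomial for each \<open>k\<close> in the range.\<close>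
  define f :: "nat \<Rightarrow> rat poly" where "f k = smult (of_nat (delannoy_coeff (Suc 0) k) ^ (a - 1)) 1 *
    (\<Sum>i\<le>n. monom (of_nat (delannoy_coeff i k) ^ h) i) ^ m" for k
  have "f \<in> delannoy_span"
    unfolding f_def
    by (intro delannoy_span_mult delannoy_span_coeff_power delannoy_span_power delannoy_span_Schmidt_sum)
  moreover have "(\<Sum>k=1..n. smult (\<epsilon> ^ k * of_nat (k ^ a * (k + 1) ^ a * (2 * k + 1))) (delannoy_poly h k ^ m)) =
      (\<Sum>k=1..n. smult (\<epsilon> ^ k * (of_nat k * (of_nat k + 1) * (2 * of_nat k + 1))) (f k))"
  proof (rule sum.cong)
    fix k assume "k \<in> {1..n}"
    then have "f k = smult (of_nat (delannoy_coeff (Suc 0) k) ^ (a - 1)) (delannoy_poly h k ^ m)"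
      using \<open>h > 0\<close> by (simp add: f_def delannoy_poly_eq_sum_delannoy_coeff[of h k n])
    moreover obtain b where "a = Suc b"
      using \<open>a > 0\<close> gr0_implies_Suc by blast
    then have "(of_nat (k ^ a * (k + 1) ^ a * (2 * k + 1)) :: rat) =
        of_nat k * (of_nat k + 1) * (2 * of_nat k + 1) * of_nat (delannoy_coeff (Suc 0) k) ^ (a - 1)"
      by (simp only: delannoy_coeff_1 diff_Suc_1 power_Suc power_mult_distrib
          of_nat_mult of_nat_power of_nat_add of_nat_1 of_nat_numeral ac_simps)
    ultimately show "smult (\<epsilon> ^ k * of_nat (k ^ a * (k + 1) ^ a * (2 * k + 1))) (delannoy_poly h k ^ m) =
        smult (\<epsilon> ^ k * (of_nat k * (of_nat k + 1) * (2 * of_nat k + 1))) (f k)"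
      by (simp only: smult_smult mult.assoc)
  qed simp
  ultimately show ?thesis
    using delannoy_span_sum_integral[OF _ \<open>n > 0\<close> \<open>\<epsilon> \<in> {-1, 1}\<close>] by simp
qed

end
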